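(* Let $X_1,X_2$ be finite sets with $|X_i|\ge2$, and for $i=1,2$ let $G_i$ be a group of homeomorphisms of $X_i^\omega$ containing the Higman–Thompson group $\mathcal{V}_{X_i}$. Then every group isomorphism $\phi:G_1\to G_2$ is induced by a homeomorphism $F:X_1^\omega\to X_2^\omega$, i.e., $\phi(g)=F\circ g\circ F^{-1}$ for all $g\in G_1$.
   Context: $X^\omega$ is the space of right-infinite sequences over $X$ with the product topology, $X^*$ the set of finite words. A complete antichain is a finite set $A\subset X^*$ of words, none a prefix of another, with $X^\omega=\bigsqcup_{v\in A}vX^\omega$. The Higman–Thompson group $\mathcal{V}_X$ is the group of homeomorphisms $g$ of $X^\omega$ for which there exist complete antichains $A_1,A_2$ and a bijection $\alpha:A_1\to A_2$ with $g(vw)=\alpha(v)w$ for all $v\in A_1$, $w\in X^\omega$. *)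

theory Defs
  imports "HOL-Analysis.Analysis" "HOL-Algebra.Group"
begin

text \<open>The alphabet X is modelled by a finite type 'a; X^omega is the type nat \<Rightarrow> 'a,
  with the product of discrete topologies; finite words X^* are lists.\<close>

definition seq_top :: "(nat \<Rightarrow> 'a) topology" where
  "seq_top = product_topology (\<lambda>_::nat. discrete_topology (UNIV::'a set)) UNIV"

definition conc :: "'a list \<Rightarrow> (nat \<Rightarrow> 'a) \<Rightarrow> (nat \<Rightarrow> 'a)" where
  "conc v w = (\<lambda>i. if i < length v then v ! i else w (i - length v))"

definition cylinder :: "'a list \<Rightarrow> (nat \<Rightarrow> 'a) set" where
  "cylinder v = {conc v w | w. True}"

definition is_prefix :: "'a list \<Rightarrow> 'a list \<Rightarrow> bool" where
  "is_prefix u v \<longleftrightarrow> (\<exists>z. v = u @ z)"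

definition complete_antichain :: "'a list set \<Rightarrow> bool" where
  "complete_antichain A \<longleftrightarrow> finite A
     \<and> (\<forall>u\<in>A. \<forall>v\<in>A. is_prefix u v \<longrightarrow> u = v)
     \<and> (\<forall>x::nat \<Rightarrow> 'a. \<exists>!v. v \<in> A \<and> x \<in> cylinder v)"

definition higman_thompson :: "((nat \<Rightarrow> 'a) \<Rightarrow> (nat \<Rightarrow> 'a)) set" where
  "higman_thompson = {g. homeomorphic_map seq_top seq_top g \<and>
     (\<exists>A1 A2 \<alpha>. complete_antichain A1 \<and> complete_antichain A2 \<and> bij_betw \<alpha> A1 A2 \<and>
        (\<forall>v\<in>A1. \<forall>w. g (conc v w) = conc (\<alpha> v) w))}"

definition comp_monoid :: "('b \<Rightarrow> 'b) set \<Rightarrow> ('b \<Rightarrow> 'b) monoid" where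
  "comp_monoid G = \<lparr>carrier = G, mult = (\<circ>), one = id\<rparr>"

definition homeo_group :: "((nat \<Rightarrow> 'a) \<Rightarrow> (nat \<Rightarrow> 'a)) set \<Rightarrow> bool" where
  "homeo_group G \<longleftrightarrow> G \<subseteq> {g. homeomorphic_map seq_top seq_top g} \<and> group (comp_monoid G)"

end

theory Submission
  imports Defs "HOL-Combinatorics.Transposition"
begin

text \<open>
  This is an instance of Rubin's theorem. Disjointness of supports can be expressed in the language
  of groups, following Belk, Elliott and Matucci, because the Higman-Thompson group supplies
  nontrivial elements with arbitrarily small support. Hence an isomorphism \<open>\<phi>\<close> preserves
  disjointness of supports, and also the relation that one support is contained in the closure of
  another.

  Call points \<open>x\<close> and \<open>y\<close> matched if the supports of \<open>\<phi> f\<close> and \<open>g\<close> meet whenever \<open>f\<close> moves \<open>x\<close> and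
  \<open>g\<close> moves \<open>y\<close>. This relation is symmetric and equivariant, and by compactness every point is
  matched. If \<open>f\<close> moves \<open>x\<close>, then some element supported inside the support of \<open>f\<close> has an image
  moving \<open>y\<close>: otherwise \<open>y\<close> would be matched with a dense subset of a neighbourhood of \<open>x\<close>. Hence the
  relation is the graph of a homeomorphism, and it induces \<open>\<phi>\<close> by equivariance.
\<close>

section \<open>Cylinders and supports\<close>

text \<open>A plain \<open>inv\<close> would be parsed as the group inverse of HOL-Algebra.\<close>

abbreviation finv :: "('b \<Rightarrow> 'b) \<Rightarrow> 'b \<Rightarrow> 'b" where
  "finv \<equiv> inv_into UNIV"

text \<open>Indexing by a point and a length instead of a word makes these directly the basic
  neighbourhoods of \<open>x\<close>.\<close>

definition cyl :: "(nat \<Rightarrow> 'a) \<Rightarrow> nat \<Rightarrow> (nat \<Rightarrow> 'a) set" where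
  "cyl x n = {y. \<forall>i<n. y i = x i}"

definition supp :: "('b \<Rightarrow> 'b) \<Rightarrow> 'b set" where
  "supp f = {x. f x \<noteq> x}"

text \<open>This is the topological closure, because the cylinders around \<open>x\<close> form a
  neighbourhood base at \<open>x\<close>.\<close>

definition cl :: "(nat \<Rightarrow> 'a) set \<Rightarrow> (nat \<Rightarrow> 'a) set" where
  "cl S = {x. \<forall>n. cyl x n \<inter> S \<noteq> {}}"

lemma cyl_refl [simp]: "x \<in> cyl x n"
  by (simp add: cyl_def)

lemma cyl_antimono: "m \<le> n \<Longrightarrow> cyl x n \<subseteq> cyl x m"
  by (auto simp: cyl_def)

lemma cyl_eq: "y \<in> cyl x n \<Longrightarrow> cyl y n = cyl x n"
  by (auto simp: cyl_def)

lemma moved_cyl_mono: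
  "f ` cyl x n \<inter> cyl x n = {} \<Longrightarrow> n \<le> m \<Longrightarrow> f ` cyl x m \<inter> cyl x m = {}"
  using cyl_antimono[of n m x] by blast

section \<open>The product topology in terms of cylinders\<close>

lemma openin_seq_top_iff: "openin seq_top S \<longleftrightarrow> (\<forall>x\<in>S. \<exists>n. cyl x n \<subseteq> S)"
proof
  assume S: "openin seq_top S"
  show "\<forall>x\<in>S. \<exists>n. cyl x n \<subseteq> S"
  proof
    fix x assume "x \<in> S"
    then obtain U where U: "finite {i. U i \<noteq> UNIV}" "x \<in> Pi\<^sub>E UNIV U" "Pi\<^sub>E UNIV U \<subseteq> S"
      using S unfolding seq_top_def openin_product_topology_alt by force
    obtain n where n: "\<And>i. U i \<noteq> UNIV \<Longrightarrow> i < n"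
      using finite_nat_set_iff_bounded[THEN iffD1, OF U(1)] by auto
    have "cyl x n \<subseteq> Pi\<^sub>E UNIV U"
    proof
      fix y assume y: "y \<in> cyl x n"
      have "y i \<in> U i" for i
      proof (cases "U i = UNIV")
        case False
        then have "y i = x i" using n y by (auto simp: cyl_def)
        then show ?thesis using U(2) by auto
      qed auto
      then show "y \<in> Pi\<^sub>E UNIV U" by auto
    qed
    then show "\<exists>n. cyl x n \<subseteq> S" using U(3) by blast
  qed
next
  assume S: "\<forall>x\<in>S. \<exists>n. cyl x n \<subseteq> S"
  show "openin seq_top S"
    unfolding seq_top_def openin_product_topology_alt
  proof
    fix x assume "x \<in> S"
    then obtain n where n: "cyl x n \<subseteq> S" using S by blast
    define U where "U = (\<lambda>i. if i < n then {x i} else UNIV)"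
    have "finite {i. U i \<noteq> UNIV}"
      by (rule finite_subset[of _ "{..<n}"]) (auto simp: U_def)
    moreover have "Pi\<^sub>E UNIV U \<subseteq> cyl x n"
    proof
      fix y assume "y \<in> Pi\<^sub>E UNIV U"
      then have "y i \<in> U i" for i by auto
      then show "y \<in> cyl x n" unfolding cyl_def U_def by (simp split: if_splits) (metis singletonD)
    qed
    ultimately show "\<exists>U. finite {i \<in> UNIV. U i \<noteq> topspace (discrete_topology UNIV)} \<and>
        (\<forall>i\<in>UNIV. openin (discrete_topology UNIV) (U i)) \<and> x \<in> Pi\<^sub>E UNIV U \<and> Pi\<^sub>E UNIV U \<subseteq> S"
      using n by (intro exI[of _ U]) (auto simp: U_def)
  qed
qed

lemma topspace_seq_top [simp]: "topspace seq_top = UNIV"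
  by (simp add: seq_top_def)

lemma openin_cyl: "openin seq_top (cyl x n)"
  unfolding openin_seq_top_iff using cyl_eq by blast

lemma compact_space_seq_top: "compact_space (seq_top :: (nat \<Rightarrow> 'a::finite) topology)"
  by (simp add: seq_top_def compact_space_product_topology compact_space_discrete_topology)

lemma closedin_cl: "closedin seq_top (cl S)"
proof -
  have "\<exists>n. cyl x n \<subseteq> - cl S" if x: "x \<notin> cl S" for x
  proof -
    obtain n where "cyl x n \<inter> S = {}" using x by (auto simp: cl_def)
    then have "cyl x n \<subseteq> - cl S" using cyl_eq by (fastforce simp: cl_def)
    then show ?thesis ..
  qed
  then show ?thesis
    by (simp add: closedin_def openin_seq_top_iff Compl_eq_Diff_UNIV[symmetric])
qed

lemma subset_cl: "S \<subseteq> cl S"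
  by (auto simp: cl_def) (use cyl_refl in blast)

lemma cl_mono: "S \<subseteq> T \<Longrightarrow> cl S \<subseteq> cl T"
  by (fastforce simp: cl_def)

lemma cl_minimal:
  assumes "S \<subseteq> cl T"
  shows "cl S \<subseteq> cl T"
proof
  fix x assume x: "x \<in> cl S"
  have "cyl x n \<inter> T \<noteq> {}" for n
  proof -
    obtain z where z: "z \<in> cyl x n" "z \<in> S" using x by (fastforce simp: cl_def)
    then have "cyl z n \<inter> T \<noteq> {}" using assms by (auto simp: cl_def)
    then show ?thesis using cyl_eq[OF z(1)] by simp
  qed
  then show "x \<in> cl T" by (simp add: cl_def)
qed

lemma cl_cyl: "cl (cyl x n) = cyl x n"
proof
  show "cl (cyl x n) \<subseteq> cyl x n"
  proof
    fix y assume "y \<in> cl (cyl x n)"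
    then obtain z where "z \<in> cyl y n" "z \<in> cyl x n" by (auto simp: cl_def)
    then show "y \<in> cyl x n" by (auto simp: cyl_def)
  qed
qed (rule subset_cl)

lemma continuous_map_seq_top_iff:
  "continuous_map seq_top seq_top f \<longleftrightarrow> (\<forall>x n. \<exists>m. f ` cyl x m \<subseteq> cyl (f x) n)"
proof
  assume f: "continuous_map seq_top seq_top f"
  show "\<forall>x n. \<exists>m. f ` cyl x m \<subseteq> cyl (f x) n"
  proof (intro allI)
    fix x n
    have "openin seq_top {y. f y \<in> cyl (f x) n}"
      using openin_continuous_map_preimage[OF f openin_cyl[of "f x" n]] by simp
    then show "\<exists>m. f ` cyl x m \<subseteq> cyl (f x) n"
      unfolding openin_seq_top_iff by (force simp: image_subset_iff)
  qed
next
  assume *: "\<forall>x n. \<exists>m. f ` cyl x m \<subseteq> cyl (f x) n"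
  have "openin seq_top {x. f x \<in> U}" if U: "openin seq_top U" for U
    unfolding openin_seq_top_iff
  proof
    fix x assume "x \<in> {x. f x \<in> U}"
    then obtain n where "cyl (f x) n \<subseteq> U" using U unfolding openin_seq_top_iff by blast
    moreover obtain m where "f ` cyl x m \<subseteq> cyl (f x) n" using * by blast
    ultimately show "\<exists>m. cyl x m \<subseteq> {x. f x \<in> U}" by blast
  qed
  then show "continuous_map seq_top seq_top f" by (simp add: continuous_map_def)
qed

section \<open>Supports and commutators of bijections\<close>

lemma supp_image: "bij f \<Longrightarrow> x \<in> supp f \<Longrightarrow> f x \<in> supp f"
  by (simp add: supp_def bij_def inj_eq)

lemma supp_image_subset: "bij f \<Longrightarrow> supp f \<subseteq> U \<Longrightarrow> x \<in> U \<Longrightarrow> f x \<in> U"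
  using supp_image[of f x] by (cases "f x = x") (auto simp: supp_def)

text \<open>Each bijection maps its own support to itself, so along the way of any point at most one
  of the two acts.\<close>

lemma supp_disjoint_commute:
  assumes "bij f" "bij g" "supp f \<inter> supp g = {}"
  shows "f \<circ> g = g \<circ> f"
proof
  fix x
  show "(f \<circ> g) x = (g \<circ> f) x"
    using assms supp_image[OF assms(1), of x] supp_image[OF assms(2), of x]
    by (cases "f x = x"; cases "g x = x") (auto simp: supp_def)
qed

lemma supp_empty_iff: "supp f = {} \<longleftrightarrow> f = id"
  by (auto simp: supp_def fun_eq_iff)

lemma bij_inv_apply: "bij f \<Longrightarrow> f (finv f x) = x" "bij f \<Longrightarrow> finv f (f x) = x"
  by (simp_all add: bij_is_surj surj_f_inv_f bij_is_inj inv_f_f)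

lemma inv_fixes: "bij f \<Longrightarrow> f x = x \<Longrightarrow> finv f x = x"
  by (metis bij_inv_apply(2))

definition comm :: "('b \<Rightarrow> 'b) \<Rightarrow> ('b \<Rightarrow> 'b) \<Rightarrow> 'b \<Rightarrow> 'b" where
  "comm f h = f \<circ> h \<circ> finv f \<circ> finv h"

text \<open>The commutator is the conjugate of \<open>h\<close> by \<open>f\<close>, supported on
  the \<open>f\<close>-image of \<open>supp h\<close>, times the inverse of
  \<open>h\<close>.\<close>

lemma supp_comm:
  assumes "bij f" "bij h"
  shows "supp (comm f h) \<subseteq> supp h \<union> f ` supp h"
proof
  fix y assume y: "y \<in> supp (comm f h)"
  show "y \<in> supp h \<union> f ` supp h"
  proof (rule ccontr)
    assume n: "y \<notin> supp h \<union> f ` supp h"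
    then have "finv h y = y" using inv_fixes assms by (auto simp: supp_def)
    moreover have "h (finv f y) = finv f y"
      using n bij_inv_apply(1)[OF assms(1), of y] by (auto simp: supp_def image_iff)
    ultimately have "comm f h y = y" by (simp add: comm_def bij_inv_apply assms)
    with y show False by (simp add: supp_def)
  qed
qed

lemma bij_comm: "bij f \<Longrightarrow> bij h \<Longrightarrow> bij (comm f h)"
  unfolding comm_def by (intro bij_comp bij_imp_bij_inv)

lemma comm_eq_id:
  assumes "bij f" "bij h" "comm f h = id"
  shows "f \<circ> h = h \<circ> f"
proof
  fix x
  \<comment> \<open>At this point both inverses cancel and the left side becomes
    \<open>f (h x)\<close>.\<close>
  have "comm f h (h (f x)) = h (f x)" using assms by simp
  then show "(f \<circ> h) x = (h \<circ> f) x" using assms by (simp add: comm_def bij_inv_apply)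
qed

section \<open>Prefix swaps\<close>

definition prefix_repl :: "(nat \<Rightarrow> 'a) \<Rightarrow> nat \<Rightarrow> (nat \<Rightarrow> 'a) \<Rightarrow> nat \<Rightarrow> 'a" where
  "prefix_repl q n x = (\<lambda>i. if i < n then q i else x i)"

text \<open>The points \<open>p\<close> and \<open>q\<close> only stand for their first
  \<open>n\<close> letters. If these agree, the first branch makes the map the identity.\<close>

definition swap_prefix :: "(nat \<Rightarrow> 'a) \<Rightarrow> (nat \<Rightarrow> 'a) \<Rightarrow> nat \<Rightarrow> (nat \<Rightarrow> 'a) \<Rightarrow> nat \<Rightarrow> 'a" where
  "swap_prefix p q n x =
     (if x \<in> cyl p n then prefix_repl q n x else if x \<in> cyl q n then prefix_repl p n x else x)"

lemma prefix_repl_in_cyl [simp]: "prefix_repl q n x \<in> cyl q n"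
  by (simp add: prefix_repl_def cyl_def)

lemma prefix_repl_absorb [simp]: "prefix_repl p n (prefix_repl q n x) = prefix_repl p n x"
  by (auto simp: prefix_repl_def)

lemma prefix_repl_id: "x \<in> cyl p n \<Longrightarrow> prefix_repl p n x = x"
  by (auto simp: prefix_repl_def cyl_def)

lemma prefix_repl_cong: "q \<in> cyl p n \<Longrightarrow> prefix_repl q n x = prefix_repl p n x"
  by (auto simp: prefix_repl_def cyl_def)

lemma swap_prefix_invol: "swap_prefix p q n (swap_prefix p q n x) = x"
proof (cases "q \<in> cyl p n")
  case True
  then show ?thesis by (simp add: swap_prefix_def prefix_repl_id prefix_repl_cong cyl_eq)
next
  case False
  then have "x \<notin> cyl p n" if "x \<in> cyl q n" for x
    using that by (metis cyl_eq cyl_refl)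
  moreover from this have "prefix_repl p n x \<notin> cyl q n" using prefix_repl_in_cyl by blast
  ultimately show ?thesis
    by (auto simp: swap_prefix_def prefix_repl_id)
qed

lemma supp_swap_prefix: "supp (swap_prefix p q n) \<subseteq> cyl p n \<union> cyl q n"
  by (auto simp: supp_def swap_prefix_def)

lemma swap_prefix_continuous: "continuous_map seq_top seq_top (swap_prefix p q n)"
  unfolding continuous_map_seq_top_iff
proof (intro allI)
  fix x k
  \<comment> \<open>Length \<open>n\<close> fixes which branch applies, and length \<open>k\<close>
    fixes the letters that are kept.\<close>
  have "swap_prefix p q n ` cyl x (max n k) \<subseteq> cyl (swap_prefix p q n x) k"
  proof
    fix y assume "y \<in> swap_prefix p q n ` cyl x (max n k)"
    then obtain z where z: "y = swap_prefix p q n z" "z \<in> cyl x (max n k)" by auto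
    have "z \<in> cyl r n \<longleftrightarrow> x \<in> cyl r n" for r
      using z(2) by (auto simp: cyl_def)
    then show "y \<in> cyl (swap_prefix p q n x) k"
      using z by (auto simp: swap_prefix_def prefix_repl_def cyl_def)
  qed
  then show "\<exists>m. swap_prefix p q n ` cyl x m \<subseteq> cyl (swap_prefix p q n x) k" ..
qed

lemma swap_prefix_homeomorphic: "homeomorphic_map seq_top seq_top (swap_prefix p q n)"
  by (rule homeomorphic_maps_imp_map[of _ _ _ "swap_prefix p q n"])
    (simp add: homeomorphic_maps_def swap_prefix_continuous swap_prefix_invol)

lemma conc_mem_cyl_iff: "length v = n \<Longrightarrow> conc v w \<in> cyl p n \<longleftrightarrow> v = map p [0..<n]"
  by (auto simp: conc_def cyl_def list_eq_iff_nth_eq)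

lemma complete_antichain_length:
  "complete_antichain {v :: 'a::finite list. length v = n}"
proof -
  have "finite {v :: 'a list. length v = n}"
    using finite_lists_length_eq[of "UNIV :: 'a set" n] by simp
  moreover have "\<exists>!v. v \<in> {v. length v = n} \<and> x \<in> cylinder v" for x :: "nat \<Rightarrow> 'a"
  proof (rule ex1I[of _ "map x [0..<n]"])
    have "x = conc (map x [0..<n]) (\<lambda>i. x (i + n))" by (auto simp: conc_def)
    then show "map x [0..<n] \<in> {v. length v = n} \<and> x \<in> cylinder (map x [0..<n])"
      unfolding cylinder_def by auto
  next
    fix v assume "v \<in> {v. length v = n} \<and> x \<in> cylinder v"
    then show "v = map x [0..<n]"
      by (auto simp: cylinder_def conc_def list_eq_iff_nth_eq)
  qed
  ultimately show ?thesis by (auto simp: complete_antichain_def is_prefix_def)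
qed

text \<open>The words of length \<open>n\<close> serve as both complete antichains, with the
  transposition of the two prefixes as the bijection.\<close>

lemma swap_prefix_higman_thompson:
  "swap_prefix p q n \<in> (higman_thompson :: ((nat \<Rightarrow> 'a::finite) \<Rightarrow> _) set)"
proof -
  define \<alpha> where "\<alpha> = Transposition.transpose (map p [0..<n]) (map q [0..<n])"
  let ?A = "{v :: 'a list. length v = n}"
  have "\<alpha> v \<in> ?A" if "v \<in> ?A" for v
    using that by (auto simp: \<alpha>_def Transposition.transpose_def)
  then have "bij_betw \<alpha> ?A ?A"
    by (intro bij_betw_byWitness[of _ \<alpha>]) (auto simp: \<alpha>_def)
  moreover have "swap_prefix p q n (conc v w) = conc (\<alpha> v) w" if "v \<in> ?A" for v w
  proof -
    have len: "length v = n" using that by simp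
    have repl: "prefix_repl r n (conc v w) = conc (map r [0..<n]) w" for r
      using len by (auto simp: prefix_repl_def conc_def)
    show ?thesis
      unfolding swap_prefix_def conc_mem_cyl_iff[OF len] repl \<alpha>_def Transposition.transpose_def
      by simp
  qed
  ultimately show ?thesis
    unfolding higman_thompson_def
    using swap_prefix_homeomorphic complete_antichain_length[of n] by blast
qed

section \<open>Groups of homeomorphisms containing the prefix swaps\<close>

text \<open>This notion of Belk, Elliott and Matucci lies between disjointness of the supports of
  \<open>f\<close> and \<open>g\<close> and disjointness of the supports of \<open>f\<close> and \<open>g ^^ 12\<close>. The exponent is the least
  one divisible by 1, 2, 3 and 4, so that a point moved by \<open>g ^^ 12\<close> has a \<open>g\<close>-orbit of size at
  least 5.\<close>

definition alg_disjoint :: "('b \<Rightarrow> 'b) set \<Rightarrow> ('b \<Rightarrow> 'b) \<Rightarrow> ('b \<Rightarrow> 'b) \<Rightarrow> bool" where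
  "alg_disjoint G f g \<longleftrightarrow> (\<forall>h\<in>G. f \<circ> h \<noteq> h \<circ> f \<longrightarrow>
     (\<exists>f1\<in>G. \<exists>f2\<in>G. f1 \<circ> g = g \<circ> f1 \<and> f2 \<circ> g = g \<circ> f2 \<and>
        comm f1 (comm f2 h) \<noteq> id \<and>
        comm f1 (comm f2 h) \<circ> g = g \<circ> comm f1 (comm f2 h)))"

text \<open>The group-theoretic form of \<open>supp k \<subseteq> cl (supp f)\<close>. Twelfth
  powers bridge the gap left by \<open>alg_disjoint\<close>: they have support disjoint from
  \<open>supp f\<close>, and are still nontrivial for suitable \<open>h\<close> in any cylinder that
  misses \<open>supp f\<close>.\<close>

definition alg_below :: "('b \<Rightarrow> 'b) set \<Rightarrow> ('b \<Rightarrow> 'b) \<Rightarrow> ('b \<Rightarrow> 'b) \<Rightarrow> bool" where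
  "alg_below G k f \<longleftrightarrow> (\<forall>h\<in>G. alg_disjoint G f h \<longrightarrow> k \<circ> h ^^ 12 = h ^^ 12 \<circ> k)"

locale swap_group =
  fixes G :: "((nat \<Rightarrow> 'a) \<Rightarrow> nat \<Rightarrow> 'a) set"
  assumes comp_closed: "f \<in> G \<Longrightarrow> g \<in> G \<Longrightarrow> f \<circ> g \<in> G"
    and id_closed: "id \<in> G"
    and inv_closed: "f \<in> G \<Longrightarrow> finv f \<in> G"
    and bijective: "f \<in> G \<Longrightarrow> bij f"
    and continuous: "f \<in> G \<Longrightarrow> \<exists>m. f ` cyl x m \<subseteq> cyl (f x) n"
    and swap_closed: "swap_prefix p q n \<in> G"
    and two_letters: "\<exists>a b :: 'a. a \<noteq> b"
begin

section \<open>Local behaviour of the group elements\<close>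

lemma comm_closed: "f \<in> G \<Longrightarrow> h \<in> G \<Longrightarrow> comm f h \<in> G"
  unfolding comm_def by (intro comp_closed inv_closed)

lemma funpow_closed: "f \<in> G \<Longrightarrow> f ^^ n \<in> G"
  by (induction n) (auto intro: comp_closed simp: id_closed)

text \<open>Take a position \<open>i\<close> where \<open>f x\<close> and \<open>x\<close> differ.
  By continuity \<open>f\<close> produces the letter \<open>f x i\<close> there on a whole cylinder,
  while the points of the cylinder carry \<open>x i\<close>.\<close>

lemma moved_cyl:
  assumes "f \<in> G" "f x \<noteq> x"
  shows "\<exists>n. f ` cyl x n \<inter> cyl x n = {}"
proof -
  obtain i where i: "f x i \<noteq> x i" using assms(2) by (auto simp: fun_eq_iff)
  obtain m where m: "f ` cyl x m \<subseteq> cyl (f x) (Suc i)" using continuous assms(1) by blast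
  have "False" if z: "z \<in> cyl x (max m (Suc i))" "f z \<in> cyl x (max m (Suc i))" for z
  proof -
    have "z \<in> cyl x m" using z(1) by (auto simp: cyl_def)
    then have "f z i = f x i" using m by (auto simp: cyl_def)
    moreover have "f z i = x i" using z(2) by (auto simp: cyl_def)
    ultimately show False using i by simp
  qed
  then have "f ` cyl x (max m (Suc i)) \<inter> cyl x (max m (Suc i)) = {}" by blast
  then show ?thesis ..
qed

lemma supp_open:
  assumes "f \<in> G" "x \<in> supp f"
  shows "\<exists>n. cyl x n \<subseteq> supp f"
proof -
  obtain n where "f ` cyl x n \<inter> cyl x n = {}" using moved_cyl[of f x] assms by (auto simp: supp_def)
  then have "cyl x n \<subseteq> supp f" by (force simp: supp_def)
  then show ?thesis ..
qed

text \<open>Swapping two prefixes of length \<open>n + 1\<close> that differ only in the last letter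
  affects only points that share the first \<open>n\<close> letters.\<close>

lemma locally_moving: "\<exists>c\<in>G. c x \<noteq> x \<and> supp c \<subseteq> cyl x n"
proof -
  obtain b where b: "b \<noteq> x n" using two_letters by metis
  let ?q = "x(n := b)"
  have "swap_prefix x ?q (Suc n) x \<noteq> x"
    using b by (auto simp: swap_prefix_def prefix_repl_def fun_eq_iff intro!: exI[of _ n])
  moreover have "supp (swap_prefix x ?q (Suc n)) \<subseteq> cyl x n"
    using supp_swap_prefix[of x ?q "Suc n"] by (fastforce simp: cyl_def)
  ultimately show ?thesis using swap_closed by blast
qed

text \<open>Swapping the prefixes of \<open>y\<close> and \<open>z\<close> of length
  \<open>max n m\<close> suffices. Thus \<open>y\<close> has a dense orbit in \<open>cyl y n\<close>
  under the elements supported there.\<close>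

lemma locally_dense: "z \<in> cyl y n \<Longrightarrow> \<exists>g\<in>G. supp g \<subseteq> cyl y n \<and> g y \<in> cyl z m"
proof -
  assume z: "z \<in> cyl y n"
  let ?k = "max n m"
  have "cyl y ?k \<union> cyl z ?k \<subseteq> cyl y n"
    using z by (auto simp: cyl_def)
  moreover have "swap_prefix y z ?k y \<in> cyl z m"
    using cyl_antimono[of m ?k z] by (auto simp: swap_prefix_def)
  ultimately show ?thesis using supp_swap_prefix swap_closed by (meson order_trans)
qed

text \<open>A 5-cycle of prefixes of length n + 3 has a nontrivial 12th power.\<close>

lemma locally_power12: "\<exists>g\<in>G. supp g \<subseteq> cyl x n \<and> g ^^ 12 \<noteq> id"
proof -
  obtain a b :: 'a where ab: "a \<noteq> b" using two_letters by blast
  define p where "p = (\<lambda>(r::'a, s, t). x(n := r, n + 1 := s, n + 2 := t))"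
  let ?n = "n + 3"
  \<comment> \<open>Three free letters give eight prefixes already over \<open>a\<close> and
    \<open>b\<close>; two would give only four, too few for a 5-cycle.\<close>
  define w where "w = (\<lambda>i::nat. p ([(a,a,a), (a,a,b), (a,b,a), (a,b,b), (b,a,a)] ! i))"
  let ?s = "\<lambda>i j. swap_prefix (w i) (w j) ?n"
  define g where "g = ?s 0 1 \<circ> ?s 1 2 \<circ> ?s 2 3 \<circ> ?s 3 4"
  have p_cyl: "p u \<in> cyl (p v) ?n \<longleftrightarrow> u = v" for u v
    by (cases u; cases v) (auto simp: p_def cyl_def all_conj_distrib split: if_splits)
  have p_repl: "prefix_repl (p v) ?n (p u) = p v" for u v
    by (cases u; cases v) (auto simp: p_def prefix_repl_def fun_eq_iff)
  have swap: "swap_prefix (p u) (p v) ?n (p t) = (if t = u then p v else if t = v then p u else p t)"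
    for u v t
    by (simp add: swap_prefix_def p_cyl p_repl)
  have "g (w 0) = w 1" "g (w 1) = w 2" "g (w 2) = w 3" "g (w 3) = w 4" "g (w 4) = w 0"
    using ab by (simp_all add: g_def w_def swap)
  \<comment> \<open>The index is 12 modulo 5.\<close>
  then have "(g ^^ 12) (w 0) = w 2" by (simp add: eval_nat_numeral)
  moreover have "w 2 \<noteq> w 0"
    using ab p_cyl by (auto simp: w_def dest: arg_cong[where f = "\<lambda>y. y \<in> cyl (p (a,a,a)) ?n"])
  ultimately have "g ^^ 12 \<noteq> id" by auto
  moreover have "supp g \<subseteq> cyl x n"
  proof
    fix y assume "y \<in> supp g"
    then have "y \<in> supp (?s 0 1) \<or> y \<in> supp (?s 1 2) \<or> y \<in> supp (?s 2 3) \<or> y \<in> supp (?s 3 4)"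
      by (auto simp: supp_def g_def)
    then obtain i where "y \<in> cyl (w i) ?n" using supp_swap_prefix by blast
    moreover have "cyl (p u) ?n \<subseteq> cyl x n" for u
      by (cases u) (force simp: p_def cyl_def)
    ultimately show "y \<in> cyl x n" unfolding w_def by blast
  qed
  moreover have "g \<in> G" unfolding g_def by (intro comp_closed swap_closed)
  ultimately show ?thesis by blast
qed

section \<open>Algebraic disjointness compared with disjoint supports\<close>

text \<open>Near a point of \<open>supp f\<close> moved by \<open>h\<close>, choose
  \<open>f1\<close> and \<open>f2\<close> with small nested supports. These and the double
  commutator are all supported inside \<open>supp f\<close>, hence commute with
  \<open>g\<close>.\<close>

lemma disjoint_imp_alg_disjoint:
  assumes f: "f \<in> G" and g: "g \<in> G" and disj: "supp f \<inter> supp g = {}"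
  shows "alg_disjoint G f g"
  unfolding alg_disjoint_def
proof (intro ballI impI)
  fix h assume h: "h \<in> G" and "f \<circ> h \<noteq> h \<circ> f"
  then obtain x where x: "x \<in> supp f" "x \<in> supp h"
    using supp_disjoint_commute bijective f by blast
  obtain n1 where n1: "cyl x n1 \<subseteq> supp f" using supp_open f x by blast
  obtain n2 where n2: "h ` cyl x n2 \<inter> cyl x n2 = {}"
    using moved_cyl[OF h, of x] x by (auto simp: supp_def)
  define n where "n = max n1 n2"
  let ?U = "cyl x n"
  have U: "?U \<subseteq> supp f" using n1 cyl_antimono[of n1 n x] by (auto simp: n_def)
  have hU: "h ` ?U \<inter> ?U = {}" using moved_cyl_mono[OF n2] by (simp add: n_def)
  obtain f2 where f2: "f2 \<in> G" "f2 x \<noteq> x" "supp f2 \<subseteq> ?U" using locally_moving by blast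
  obtain m' where m': "f2 ` cyl x m' \<inter> cyl x m' = {}" using moved_cyl f2 by blast
  define m where "m = max n m'"
  have m: "f2 ` cyl x m \<inter> cyl x m = {}" using moved_cyl_mono[OF m'] by (simp add: m_def)
  have mU: "cyl x m \<subseteq> ?U" using cyl_antimono[of n m x] by (auto simp: m_def)
  obtain f1 where f1: "f1 \<in> G" "f1 x \<noteq> x" "supp f1 \<subseteq> cyl x m" using locally_moving by blast
  have bij: "bij f1" "bij f2" "bij g" "bij h" using bijective f1 f2 g h by auto
  define c where "c = comm f2 h"
  have "c \<in> G" unfolding c_def using comm_closed f2 h by blast
  then have bc: "bij c" using bijective by blast
  \<comment> \<open>As \<open>h\<close> pushes \<open>?U\<close> off itself, its inverse takes
    \<open>y\<close> out of \<open>?U\<close>, where \<open>f2\<close> does nothing.\<close>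
  have c_U: "c y = f2 y" if y: "y \<in> ?U" for y
  proof -
    have "finv h y \<notin> ?U" using hU y bij_inv_apply(1)[OF bij(4), of y] by (metis IntI empty_iff image_eqI)
    then have "finv f2 (finv h y) = finv h y"
      using inv_fixes[OF bij(2)] f2(3) by (auto simp: supp_def)
    then show ?thesis by (simp add: c_def comm_def bij_inv_apply bij)
  qed
  define k where "k = comm f1 c"
  \<comment> \<open>Otherwise \<open>f1\<close> and \<open>f2\<close> would commute at
    \<open>x\<close>. But \<open>f1\<close> moves \<open>x\<close> and fixes \<open>f2 x\<close>,
    which lies outside \<open>cyl x m\<close>.\<close>
  have k: "k \<noteq> id"
  proof
    assume "k = id"
    then have "f1 \<circ> c = c \<circ> f1" using comm_eq_id bij bc by (simp add: k_def)
    then have eq: "f1 (c x) = c (f1 x)" by (simp add: fun_eq_iff)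
    have "f1 x \<in> ?U" using supp_image_subset[OF bij(1) f1(3)] mU cyl_refl by blast
    then have "c (f1 x) = f2 (f1 x)" "c x = f2 x" using c_U by auto
    moreover have "f1 (f2 x) = f2 x" using m f1(3) by (force simp: supp_def)
    ultimately have "f2 (f1 x) = f2 x" using eq by simp
    then show False using f1(2) bij(2) by (simp add: bij_is_inj inj_eq)
  qed
  \<comment> \<open>Although \<open>c\<close> may act outside \<open>?U\<close>, it maps
    \<open>?U\<close> into itself as \<open>f2\<close> does. So outside \<open>?U\<close> the map
    \<open>f1\<close> has no effect and \<open>c\<close> cancels against its inverse.\<close>
  have kU: "supp k \<subseteq> ?U"
  proof
    fix y assume y: "y \<in> supp k"
    show "y \<in> ?U"
    proof (rule ccontr)
      assume nU: "y \<notin> ?U"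
      have "finv c y \<notin> ?U"
        using nU c_U[of "finv c y"] supp_image_subset[OF bij(2) f2(3), of "finv c y"]
          bij_inv_apply(1)[OF bc, of y] by auto
      then have "finv f1 (finv c y) = finv c y"
        using inv_fixes[OF bij(1)] f1(3) mU by (auto simp: supp_def)
      moreover have "f1 y = y" using nU f1(3) mU by (auto simp: supp_def)
      ultimately have "k y = y" by (simp add: k_def comm_def bij_inv_apply bc)
      then show False using y by (simp add: supp_def)
    qed
  qed
  have commute: "e \<circ> g = g \<circ> e" if "bij e" "supp e \<subseteq> ?U" for e
    using supp_disjoint_commute[OF that(1) bij(3)] that(2) U disj by blast
  have "bij k" unfolding k_def using bij_comm bij(1) bc by blast
  then have "k \<circ> g = g \<circ> k" using commute kU by blast
  moreover have "f1 \<circ> g = g \<circ> f1" "f2 \<circ> g = g \<circ> f2"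
    using commute bij f1(3) f2(3) mU by auto
  ultimately show "\<exists>f1\<in>G. \<exists>f2\<in>G. f1 \<circ> g = g \<circ> f1 \<and> f2 \<circ> g = g \<circ> f2 \<and>
        comm f1 (comm f2 h) \<noteq> id \<and> comm f1 (comm f2 h) \<circ> g = g \<circ> comm f1 (comm f2 h)"
    using f1(1) f2(1) k unfolding k_def c_def by blast
qed

text \<open>The support of the double commutator is covered by four translates of a small cylinder
  by elements commuting with g, while a g-orbit of length at least 5 meets each at most once.\<close>

lemma alg_disjoint_imp_disjoint_power:
  assumes f: "f \<in> G" and g: "g \<in> G" and ad: "alg_disjoint G f g"
  shows "supp f \<inter> supp (g ^^ 12) = {}"
proof (rule ccontr)
  assume "supp f \<inter> supp (g ^^ 12) \<noteq> {}"
  then obtain x where x: "f x \<noteq> x" "(g ^^ 12) x \<noteq> x" by (auto simp: supp_def)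
  \<comment> \<open>Each of 1, 2, 3, 4 divides 12, so none of them can be a period of
    \<open>x\<close>.\<close>
  have gi: "(g ^^ i) x \<noteq> x" if i: "i \<in> {1..4}" for i
  proof
    assume fixed: "(g ^^ i) x = x"
    have "(g ^^ (j * i)) x = x" for j
      by (induction j) (auto simp: funpow_add fixed)
    moreover have "i dvd 12"
    proof -
      have "i = 1 \<or> i = 2 \<or> i = 3 \<or> i = 4" using i by auto
      then show ?thesis by auto
    qed
    ultimately show False using x(2) by (metis dvd_def mult.commute)
  qed
  have "\<exists>n. f ` cyl x n \<inter> cyl x n = {}" using moved_cyl f x by blast
  then obtain nf where nf: "f ` cyl x nf \<inter> cyl x nf = {}" by blast
  have "\<forall>i\<in>{1..4}. \<exists>n. (g ^^ i) ` cyl x n \<inter> cyl x n = {}"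
    using moved_cyl funpow_closed g gi by blast
  then obtain N where N: "\<And>i. i \<in> {1..4} \<Longrightarrow> (g ^^ i) ` cyl x (N i) \<inter> cyl x (N i) = {}"
    by metis
  define n where "n = max nf (Max (N ` {1..4}))"
  let ?U = "cyl x n"
  have fU: "f ` ?U \<inter> ?U = {}" using moved_cyl_mono[OF nf] by (simp add: n_def)
  have gU: "(g ^^ i) ` ?U \<inter> ?U = {}" if i: "i \<in> {1..4}" for i
  proof -
    have "N i \<le> Max (N ` {1..4})" using i by (intro Max_ge) auto
    then show ?thesis using moved_cyl_mono[OF N[OF i]] by (simp add: n_def)
  qed
  \<comment> \<open>Since \<open>f\<close> carries \<open>?U\<close> off itself, such an
    \<open>h\<close> cannot commute with \<open>f\<close>, and the hypothesis applies to it.\<close>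
  obtain h where h: "h \<in> G" "h x \<noteq> x" "supp h \<subseteq> ?U" using locally_moving by blast
  have "f \<circ> h \<noteq> h \<circ> f"
  proof
    assume "f \<circ> h = h \<circ> f"
    then have "f (h x) = h (f x)" by (simp add: fun_eq_iff)
    also have "h (f x) = f x" using fU h(3) by (force simp: supp_def)
    finally show False using h(2) bijective[OF f] by (simp add: bij_is_inj inj_eq)
  qed
  then obtain f1 f2 where f12: "f1 \<in> G" "f2 \<in> G" "f1 \<circ> g = g \<circ> f1" "f2 \<circ> g = g \<circ> f2"
    and k: "comm f1 (comm f2 h) \<noteq> id" "comm f1 (comm f2 h) \<circ> g = g \<circ> comm f1 (comm f2 h)"
    using ad h(1) unfolding alg_disjoint_def by blast
  let ?k = "comm f1 (comm f2 h)"
  let ?E = "{id, f2, f1, f1 \<circ> f2}"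
  have bij: "bij f1" "bij f2" "bij h" "bij g" using bijective f12 h g by auto
  have "supp ?k \<subseteq> supp (comm f2 h) \<union> f1 ` supp (comm f2 h)"
    using supp_comm bij bij_comm by blast
  moreover have "supp (comm f2 h) \<subseteq> ?U \<union> f2 ` ?U" using supp_comm[OF bij(2,3)] h(3) by blast
  ultimately have sub: "supp ?k \<subseteq> (?U \<union> f2 ` ?U) \<union> f1 ` (?U \<union> f2 ` ?U)"
    by (meson Un_mono image_mono order_trans)
  have cover: "\<exists>e\<in>?E. z \<in> e ` ?U" if "z \<in> supp ?k" for z
    using subsetD[OF sub that] by (simp add: image_Un image_comp)
  have Eg: "e (g z) = g (e z)" if "e \<in> ?E" for e z
    using that fun_cong[OF f12(3)] fun_cong[OF f12(4)] by auto
  then have Egi: "e ((g ^^ i) z) = (g ^^ i) (e z)" if "e \<in> ?E" for e z i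
    using that by (induction i) auto
  obtain y where y: "y \<in> supp ?k" using k(1) supp_empty_iff by blast
  have kg: "?k (g z) = g (?k z)" for z using k(2) by (simp add: fun_eq_iff)
  have "(g ^^ i) y \<in> supp ?k" for i
    using y bij(4) by (induction i) (auto simp: supp_def kg bij_is_inj inj_eq)
  then have "\<forall>i. \<exists>e\<in>?E. (g ^^ i) y \<in> e ` ?U" using cover by blast
  then obtain e where e: "\<And>i. e i \<in> ?E" "\<And>i. (g ^^ i) y \<in> e i ` ?U" by metis
  \<comment> \<open>Five orbit points lie in at most four translates. Pulling two points in one
    translate back by \<open>e i\<close>, which commutes with \<open>g\<close>, yields
    \<open>u\<close> and \<open>(g ^^ (j - i)) u\<close> both in \<open>?U\<close>.\<close>
  have "card (e ` {0..4}) \<le> card ?E" using e(1) by (intro card_mono) auto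
  also have "\<dots> < card {0..4::nat}" by (auto simp: card_insert_if)
  finally have "\<not> inj_on e {0..4}" by (rule pigeonhole)
  then obtain i j where "e i = e j" "i \<noteq> j" "i \<le> 4" "j \<le> 4" by (auto simp: inj_on_def)
  then obtain i j where ij: "e i = e j" "i < j" "j \<le> 4"
    by (metis linorder_neqE_nat)
  obtain u where u: "u \<in> ?U" "(g ^^ i) y = e i u" using e(2) by blast
  obtain v where v: "v \<in> ?U" "(g ^^ j) y = e i v" using e(2)[of j] ij by auto
  have "(g ^^ j) y = (g ^^ (j - i)) ((g ^^ i) y)"
    using ij(2) by (metis add_diff_inverse_nat comp_apply funpow_add add.commute not_less_iff_gr_or_eq)
  also have "\<dots> = e i ((g ^^ (j - i)) u)" using u Egi[OF e(1)] by simp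
  finally have "e i v = e i ((g ^^ (j - i)) u)" using v by simp
  moreover have "bij (e i)" using e(1)[of i] bij by (auto intro: bij_comp)
  ultimately have "v = (g ^^ (j - i)) u" by (simp add: bij_is_inj inj_eq)
  moreover have "(g ^^ (j - i)) ` ?U \<inter> ?U = {}" using ij by (intro gU) auto
  ultimately show False using u v by blast
qed

section \<open>Closure inclusion and disjointness in terms of the group\<close>

text \<open>If \<open>k\<close> moves a point outside the closure, then an \<open>h\<close> with
  small support there and nontrivial twelfth power is disjoint from \<open>f\<close>, but
  \<open>k\<close> does not commute with that power. Conversely, the open set
  \<open>supp (h ^^ 12)\<close> misses \<open>supp f\<close>, hence also its closure.\<close>

lemma alg_below_iff:
  assumes f: "f \<in> G" and k: "k \<in> G"
  shows "alg_below G k f \<longleftrightarrow> supp k \<subseteq> cl (supp f)"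
proof
  assume below: "alg_below G k f"
  show "supp k \<subseteq> cl (supp f)"
  proof (rule ccontr)
    assume "\<not> supp k \<subseteq> cl (supp f)"
    then obtain x n1 where x: "k x \<noteq> x" "cyl x n1 \<inter> supp f = {}" by (auto simp: supp_def cl_def)
    obtain n2 where n2: "k ` cyl x n2 \<inter> cyl x n2 = {}" using moved_cyl k x by blast
    define n where "n = max n1 n2"
    have kU: "k ` cyl x n \<inter> cyl x n = {}" using moved_cyl_mono[OF n2] by (simp add: n_def)
    have fU: "cyl x n \<inter> supp f = {}" using x(2) cyl_antimono[of n1 n x] by (auto simp: n_def)
    obtain h where h: "h \<in> G" "supp h \<subseteq> cyl x n" "h ^^ 12 \<noteq> id" using locally_power12 by blast
    have "alg_disjoint G f h" using disjoint_imp_alg_disjoint f h fU by blast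
    then have comm: "k \<circ> h ^^ 12 = h ^^ 12 \<circ> k" using below h unfolding alg_below_def by blast
    obtain p where p: "(h ^^ 12) p \<noteq> p" using h(3) by (auto simp: fun_eq_iff)
    have fixed: "(h ^^ i) z = z" if "z \<notin> cyl x n" for z i
      using that h(2) by (induction i) (auto simp: supp_def)
    have "p \<in> cyl x n" using p fixed by blast
    then have "(h ^^ 12) (k p) = k p" using kU fixed by blast
    then have "k ((h ^^ 12) p) = k p" using comm by (metis comp_apply)
    then show False using p bijective[OF k] by (simp add: bij_is_inj inj_eq)
  qed
next
  assume below: "supp k \<subseteq> cl (supp f)"
  show "alg_below G k f"
    unfolding alg_below_def
  proof (intro ballI impI)
    fix h assume h: "h \<in> G" "alg_disjoint G f h"
    then have disj: "supp f \<inter> supp (h ^^ 12) = {}" using alg_disjoint_imp_disjoint_power f by blast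
    have hG: "h ^^ 12 \<in> G" using funpow_closed h by blast
    have "supp k \<inter> supp (h ^^ 12) = {}"
    proof (rule ccontr)
      assume "supp k \<inter> supp (h ^^ 12) \<noteq> {}"
      then obtain x where x: "x \<in> supp k" "x \<in> supp (h ^^ 12)" by blast
      then obtain n where "cyl x n \<subseteq> supp (h ^^ 12)" using supp_open hG by blast
      moreover have "cyl x n \<inter> supp f \<noteq> {}" using x below by (auto simp: cl_def)
      ultimately show False using disj by blast
    qed
    then show "k \<circ> h ^^ 12 = h ^^ 12 \<circ> k" using supp_disjoint_commute bijective k hG by blast
  qed
qed

text \<open>A nonempty open set inside both closures meets \<open>supp f\<close> in an open set,
  which in turn meets \<open>supp g\<close>. Conversely, overlapping supports contain a cylinder
  that carries a nontrivial \<open>k\<close>. This makes exact what \<open>alg_disjoint\<close> only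
  approximates.\<close>

lemma disjoint_iff_alg_below:
  assumes f: "f \<in> G" and g: "g \<in> G"
  shows "supp f \<inter> supp g = {} \<longleftrightarrow> (\<forall>k\<in>G. alg_below G k f \<and> alg_below G k g \<longrightarrow> k = id)"
proof
  assume disj: "supp f \<inter> supp g = {}"
  show "\<forall>k\<in>G. alg_below G k f \<and> alg_below G k g \<longrightarrow> k = id"
  proof (intro ballI impI, rule ccontr)
    fix k assume k: "k \<in> G" "alg_below G k f \<and> alg_below G k g" "k \<noteq> id"
    then obtain x where x: "x \<in> supp k" using supp_empty_iff by blast
    obtain n where n: "cyl x n \<subseteq> supp k" using supp_open k x by blast
    have sub: "supp k \<subseteq> cl (supp f)" "supp k \<subseteq> cl (supp g)" using k alg_below_iff f g by auto
    obtain z where z: "z \<in> cyl x n" "z \<in> supp f" using sub(1) x by (fastforce simp: cl_def)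
    obtain m where m: "cyl z m \<subseteq> supp f" using supp_open f z by blast
    have "cyl z m \<inter> supp g \<noteq> {}" using sub(2) z n by (auto simp: cl_def)
    then show False using m disj by blast
  qed
next
  assume alg: "\<forall>k\<in>G. alg_below G k f \<and> alg_below G k g \<longrightarrow> k = id"
  show "supp f \<inter> supp g = {}"
  proof (rule ccontr)
    assume "supp f \<inter> supp g \<noteq> {}"
    then obtain x where x: "x \<in> supp f" "x \<in> supp g" by blast
    obtain n1 n2 where "cyl x n1 \<subseteq> supp f" "cyl x n2 \<subseteq> supp g" using supp_open f g x by meson
    then have n: "cyl x (max n1 n2) \<subseteq> supp f" "cyl x (max n1 n2) \<subseteq> supp g"
      using cyl_antimono[of _ "max n1 n2" x] by (meson max.cobounded1 max.cobounded2 order_trans)+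
    obtain k where k: "k \<in> G" "k x \<noteq> x" "supp k \<subseteq> cyl x (max n1 n2)" using locally_moving by blast
    have "supp k \<subseteq> cl (supp f)" "supp k \<subseteq> cl (supp g)" using k(3) n subset_cl by blast+
    then have "k = id" using alg alg_below_iff f g k(1) by blast
    then show False using k(2) by simp
  qed
qed

text \<open>Reduces closure inclusion to disjointness, so that a map preserving the latter preserves
  the former. Elements of small support detect points of \<open>supp k\<close> outside the
  closure.\<close>

lemma below_iff_disjoint:
  assumes f: "f \<in> G" and k: "k \<in> G"
  shows "supp k \<subseteq> cl (supp f) \<longleftrightarrow> (\<forall>h\<in>G. supp h \<inter> supp f = {} \<longrightarrow> supp h \<inter> supp k = {})"
proof
  assume sub: "supp k \<subseteq> cl (supp f)"
  show "\<forall>h\<in>G. supp h \<inter> supp f = {} \<longrightarrow> supp h \<inter> supp k = {}"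
  proof (intro ballI impI, rule ccontr)
    fix h assume h: "h \<in> G" "supp h \<inter> supp f = {}" "supp h \<inter> supp k \<noteq> {}"
    then obtain x where x: "x \<in> supp h" "x \<in> supp k" by blast
    obtain n where "cyl x n \<subseteq> supp h" using supp_open h x by blast
    moreover have "cyl x n \<inter> supp f \<noteq> {}" using sub x by (auto simp: cl_def)
    ultimately show False using h by blast
  qed
next
  assume *: "\<forall>h\<in>G. supp h \<inter> supp f = {} \<longrightarrow> supp h \<inter> supp k = {}"
  show "supp k \<subseteq> cl (supp f)"
  proof (rule ccontr)
    assume "\<not> supp k \<subseteq> cl (supp f)"
    then obtain x n where x: "x \<in> supp k" "cyl x n \<inter> supp f = {}" by (auto simp: cl_def)
    obtain h where h: "h \<in> G" "h x \<noteq> x" "supp h \<subseteq> cyl x n" using locally_moving by blast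
    then have "supp h \<inter> supp k = {}" using * x(2) by blast
    then show False using h(2) x(1) by (auto simp: supp_def)
  qed
qed

end

section \<open>Reconstruction of the space\<close>

locale swap_group_iso = A: swap_group G1 + B: swap_group G2
  for G1 :: "((nat \<Rightarrow> 'a::finite) \<Rightarrow> nat \<Rightarrow> 'a) set"
    and G2 :: "((nat \<Rightarrow> 'b::finite) \<Rightarrow> nat \<Rightarrow> 'b) set" +
  fixes \<phi> :: "((nat \<Rightarrow> 'a) \<Rightarrow> nat \<Rightarrow> 'a) \<Rightarrow> (nat \<Rightarrow> 'b) \<Rightarrow> nat \<Rightarrow> 'b"
  assumes phi_bij: "bij_betw \<phi> G1 G2"
    and phi_comp: "f \<in> G1 \<Longrightarrow> g \<in> G1 \<Longrightarrow> \<phi> (f \<circ> g) = \<phi> f \<circ> \<phi> g"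
begin

section \<open>Transport of the support relations along the isomorphism\<close>

lemma phi_image: "\<phi> ` G1 = G2"
  using phi_bij by (simp add: bij_betw_def)

lemma phi_closed: "f \<in> G1 \<Longrightarrow> \<phi> f \<in> G2"
  using phi_image by blast

lemma phi_eq_iff: "f \<in> G1 \<Longrightarrow> g \<in> G1 \<Longrightarrow> \<phi> f = \<phi> g \<longleftrightarrow> f = g"
  using phi_bij by (meson bij_betw_def inj_on_eq_iff)

lemma phi_id: "\<phi> id = id"
proof -
  have "\<phi> id \<circ> \<phi> id = \<phi> id" using phi_comp[OF A.id_closed A.id_closed] by simp
  moreover have "bij (\<phi> id)" using phi_closed A.id_closed B.bijective by blast
  ultimately have "\<phi> id y = y" for y by (metis bij_is_inj comp_apply injD)
  then show ?thesis by auto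
qed

lemma phi_eq_id_iff: "f \<in> G1 \<Longrightarrow> \<phi> f = id \<longleftrightarrow> f = id"
  using phi_eq_iff[OF _ A.id_closed] phi_id by auto

lemma phi_inv:
  assumes "f \<in> G1"
  shows "\<phi> (finv f) = finv (\<phi> f)"
proof -
  have "finv f \<in> G1" "f \<circ> finv f = id" "finv f \<circ> f = id"
    using assms A.inv_closed A.bijective by (auto simp: bij_inv_apply)
  then have "\<phi> f \<circ> \<phi> (finv f) = id" "\<phi> (finv f) \<circ> \<phi> f = id"
    using phi_comp phi_id assms by metis+
  then show ?thesis by (simp add: inv_unique_comp)
qed

lemma phi_comm: "f \<in> G1 \<Longrightarrow> h \<in> G1 \<Longrightarrow> \<phi> (comm f h) = comm (\<phi> f) (\<phi> h)"
  by (simp add: comm_def phi_comp phi_inv A.comp_closed A.inv_closed)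

lemma phi_funpow: "f \<in> G1 \<Longrightarrow> \<phi> (f ^^ n) = \<phi> f ^^ n"
  by (induction n) (simp_all add: phi_id[unfolded id_def] phi_id phi_comp A.funpow_closed)

lemma phi_commute_iff:
  "f \<in> G1 \<Longrightarrow> h \<in> G1 \<Longrightarrow> \<phi> f \<circ> \<phi> h = \<phi> h \<circ> \<phi> f \<longleftrightarrow> f \<circ> h = h \<circ> f"
  by (metis phi_comp phi_eq_iff A.comp_closed)

text \<open>Writing \<open>G2\<close> as the image of \<open>G1\<close> turns its quantifiers into
  quantifiers over \<open>G1\<close>, and \<open>\<phi>\<close> respects all the
  ingredients.\<close>

lemma alg_disjoint_phi:
  assumes "f \<in> G1" "g \<in> G1"
  shows "alg_disjoint G2 (\<phi> f) (\<phi> g) \<longleftrightarrow> alg_disjoint G1 f g"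
  unfolding alg_disjoint_def phi_image[symmetric] ball_simps bex_simps
  using assms
  by (intro ball_cong bex_cong refl)
    (simp add: phi_comm[symmetric] phi_commute_iff phi_eq_id_iff A.comm_closed cong: bex_cong)

lemma alg_below_phi:
  assumes "f \<in> G1" "k \<in> G1"
  shows "alg_below G2 (\<phi> k) (\<phi> f) \<longleftrightarrow> alg_below G1 k f"
  unfolding alg_below_def phi_image[symmetric] ball_simps
  using assms
  by (intro ball_cong refl)
    (simp add: alg_disjoint_phi[unfolded phi_image[symmetric]] phi_funpow[symmetric] phi_commute_iff A.funpow_closed)

lemma disjoint_phi:
  assumes "f \<in> G1" "g \<in> G1"
  shows "supp (\<phi> f) \<inter> supp (\<phi> g) = {} \<longleftrightarrow> supp f \<inter> supp g = {}"
proof -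
  have "(\<forall>k\<in>G2. alg_below G2 k (\<phi> f) \<and> alg_below G2 k (\<phi> g) \<longrightarrow> k = id)
      \<longleftrightarrow> (\<forall>k\<in>G1. alg_below G2 (\<phi> k) (\<phi> f) \<and> alg_below G2 (\<phi> k) (\<phi> g) \<longrightarrow> \<phi> k = id)"
    using phi_image by blast
  also have "\<dots> \<longleftrightarrow> (\<forall>k\<in>G1. alg_below G1 k f \<and> alg_below G1 k g \<longrightarrow> k = id)"
    using assms by (simp add: alg_below_phi phi_eq_id_iff)
  finally show ?thesis
    using assms by (simp add: A.disjoint_iff_alg_below B.disjoint_iff_alg_below phi_closed)
qed

lemma below_phi:
  assumes "f \<in> G1" "k \<in> G1"
  shows "supp (\<phi> k) \<subseteq> cl (supp (\<phi> f)) \<longleftrightarrow> supp k \<subseteq> cl (supp f)"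
proof -
  have "supp (\<phi> k) \<subseteq> cl (supp (\<phi> f)) \<longleftrightarrow>
      (\<forall>h\<in>G1. supp (\<phi> h) \<inter> supp (\<phi> f) = {} \<longrightarrow> supp (\<phi> h) \<inter> supp (\<phi> k) = {})"
    using assms B.below_iff_disjoint[OF phi_closed phi_closed] phi_image by blast
  then show ?thesis
    using assms by (simp add: disjoint_phi A.below_iff_disjoint)
qed

lemma phi_inv_into:
  "g \<in> G2 \<Longrightarrow> inv_into G1 \<phi> g \<in> G1" "g \<in> G2 \<Longrightarrow> \<phi> (inv_into G1 \<phi> g) = g"
  using phi_image inv_into_into[of g \<phi> G1] f_inv_into_f[of g \<phi> G1] by auto

text \<open>Makes every later result available with the two spaces exchanged.\<close>

lemma inverse: "swap_group_iso G2 G1 (inv_into G1 \<phi>)"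
proof
  show "bij_betw (inv_into G1 \<phi>) G2 G1" using phi_bij by (rule bij_betw_inv_into)
  fix f g assume fg: "f \<in> G2" "g \<in> G2"
  then have "\<phi> (inv_into G1 \<phi> (f \<circ> g)) = \<phi> (inv_into G1 \<phi> f \<circ> inv_into G1 \<phi> g)"
    by (simp add: phi_comp phi_inv_into B.comp_closed)
  then show "inv_into G1 \<phi> (f \<circ> g) = inv_into G1 \<phi> f \<circ> inv_into G1 \<phi> g"
    by (rule iffD1[OF phi_eq_iff, rotated -1]) (intro A.comp_closed B.comp_closed phi_inv_into fg)+
qed

section \<open>The matching relation between points\<close>

text \<open>Equivalent to \<open>y\<close> lying in \<open>cl (supp (\<phi> f))\<close> for every
  \<open>f\<close> that moves \<open>x\<close>; quantifying over \<open>g\<close> as well gives a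
  form symmetric in the two spaces.\<close>

definition match :: "(nat \<Rightarrow> 'a) \<Rightarrow> (nat \<Rightarrow> 'b) \<Rightarrow> bool" where
  "match x y \<longleftrightarrow> (\<forall>f\<in>G1. \<forall>g\<in>G2. f x \<noteq> x \<longrightarrow> g y \<noteq> y \<longrightarrow> supp (\<phi> f) \<inter> supp g \<noteq> {})"

lemma match_equivariant:
  assumes m: "match x y" and h: "h \<in> G1"
  shows "match (h x) (\<phi> h y)"
  unfolding match_def
proof (intro ballI impI)
  fix f g assume f: "f \<in> G1" "f (h x) \<noteq> h x" and g: "g \<in> G2" "g (\<phi> h y) \<noteq> \<phi> h y"
  have bij: "bij h" "bij (\<phi> h)" using A.bijective B.bijective phi_closed h by auto
  \<comment> \<open>Conjugation carries elements moving \<open>h x\<close> and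
    \<open>\<phi> h y\<close> back to elements moving \<open>x\<close> and \<open>y\<close>.\<close>
  let ?f = "finv h \<circ> f \<circ> h" and ?g = "finv (\<phi> h) \<circ> g \<circ> \<phi> h"
  have "?f x \<noteq> x" "?g y \<noteq> y"
    using f(2) g(2) bij_inv_apply[OF bij(1)] bij_inv_apply[OF bij(2)] by (metis comp_apply)+
  moreover have "?f \<in> G1" "?g \<in> G2"
    using f g h by (simp_all add: A.comp_closed A.inv_closed B.comp_closed B.inv_closed phi_closed)
  ultimately obtain w where w: "w \<in> supp (\<phi> ?f)" "w \<in> supp ?g"
    using m unfolding match_def by blast
  have "\<phi> ?f = finv (\<phi> h) \<circ> \<phi> f \<circ> \<phi> h"
    using f(1) h by (simp add: phi_comp phi_inv A.comp_closed A.inv_closed)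
  then have "\<phi> h w \<in> supp (\<phi> f)" "\<phi> h w \<in> supp g"
    using w by (auto simp: supp_def bij_inv_apply[OF bij(2)])
  then show "supp (\<phi> f) \<inter> supp g \<noteq> {}" by blast
qed

text \<open>Elements moving \<open>x\<close> with nested supports shrinking to \<open>x\<close> have
  images whose supports have nested nonempty closures. By compactness these share a point, which
  serves as \<open>y\<close>.\<close>

lemma match_exists: "\<exists>y. match x y"
proof -
  let ?P = "\<lambda>n c. c \<in> G1 \<and> c x \<noteq> x \<and> supp c \<subseteq> cyl x n"
  have "\<exists>c. \<forall>n. ?P n (c n) \<and> supp (c (Suc n)) \<subseteq> supp (c n)"
  proof (rule dependent_nat_choice)
    show "\<exists>c. ?P 0 c" using A.locally_moving by blast
    fix c n assume c: "?P n c"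
    then obtain m where m: "cyl x m \<subseteq> supp c" using A.supp_open[of c x] by (auto simp: supp_def)
    obtain d where d: "d \<in> G1" "d x \<noteq> x" "supp d \<subseteq> cyl x (max m (Suc n))"
      using A.locally_moving by blast
    moreover have "cyl x (max m (Suc n)) \<subseteq> cyl x m" "cyl x (max m (Suc n)) \<subseteq> cyl x (Suc n)"
      by (simp_all add: cyl_antimono)
    ultimately show "\<exists>d. ?P (Suc n) d \<and> supp d \<subseteq> supp c" using m by blast
  qed
  then obtain c where c: "\<And>n. ?P n (c n)" "\<And>n. supp (c (Suc n)) \<subseteq> supp (c n)" by blast
  define C where "C = (\<lambda>n. cl (supp (\<phi> (c n))))"
  have dec: "supp (c n) \<subseteq> supp (c m)" if "m \<le> n" for m n
    using that lift_Suc_antimono_le[of "\<lambda>n. supp (c n)"] c(2) by blast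
  have "supp (\<phi> (c n)) \<subseteq> C m" if "m \<le> n" for m n
    unfolding C_def using below_phi c(1) dec[OF that] subset_cl by blast
  then have "C n \<subseteq> C m" if "m \<le> n" for m n
    using that cl_minimal unfolding C_def by blast
  then have "decseq C" by (simp add: decseq_def)
  moreover have "C n \<noteq> {}" for n
  proof -
    have "c n \<noteq> id" using c(1)[of n] by auto
    then have "supp (\<phi> (c n)) \<noteq> {}" using supp_empty_iff phi_eq_id_iff c(1) by metis
    then show ?thesis unfolding C_def using subset_cl by blast
  qed
  ultimately have "\<Inter> (range C) \<noteq> {}"
    by (intro compact_space_imp_nest[OF compact_space_seq_top]) (auto simp: C_def closedin_cl)
  then obtain y where y: "\<And>n. y \<in> C n" by blast
  have "match x y"
    unfolding match_def
  proof (intro ballI impI)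
    fix f g assume f: "f \<in> G1" "f x \<noteq> x" and g: "g \<in> G2" "g y \<noteq> y"
    obtain n where "cyl x n \<subseteq> supp f" using A.supp_open[of f x] f by (auto simp: supp_def)
    then have "supp (c n) \<subseteq> cl (supp f)" using c(1) subset_cl by blast
    then have sub: "supp (\<phi> (c n)) \<subseteq> cl (supp (\<phi> f))" using below_phi f c(1) by blast
    obtain m where m: "cyl y m \<subseteq> supp g" using B.supp_open[of g y] g by (auto simp: supp_def)
    obtain z where z: "z \<in> cyl y m" "z \<in> supp (\<phi> (c n))"
      using y[of n] by (fastforce simp: C_def cl_def)
    then have "cyl z m \<inter> supp (\<phi> f) \<noteq> {}" using sub by (auto simp: cl_def)
    then show "supp (\<phi> f) \<inter> supp g \<noteq> {}" using m cyl_eq[OF z(1)] by blast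
  qed
  then show ?thesis by blast
qed

text \<open>If all elements supported near x had images fixing y, then y would match a dense subset
  of a neighbourhood of x, although the space offers nontrivial elements whose images are
  supported away from y.\<close>

lemma match_moves:
  assumes xy: "match x y" and f: "f \<in> G1" "f x \<noteq> x"
  shows "\<exists>f'\<in>G1. supp f' \<subseteq> supp f \<and> \<phi> f' y \<noteq> y"
proof (rule ccontr)
  assume not: "\<not> ?thesis"
  obtain n where n: "cyl x n \<subseteq> supp f" using A.supp_open[of f x] f by (auto simp: supp_def)
  \<comment> \<open>Some \<open>f'\<close> supported near \<open>x\<close> brings \<open>x\<close>
    into \<open>supp f0\<close>, while \<open>\<phi> f'\<close> fixes \<open>y\<close> by
    assumption. Equivariance then matches \<open>f' x\<close> with \<open>y\<close>.\<close>
  have meets: "supp (\<phi> f0) \<inter> supp g \<noteq> {}"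
    if f0: "f0 \<in> G1" "f0 \<noteq> id" "supp f0 \<subseteq> cyl x n" and g: "g \<in> G2" "g y \<noteq> y" for f0 g
  proof -
    obtain z where z: "z \<in> supp f0" using f0(2) supp_empty_iff by blast
    obtain m where m: "cyl z m \<subseteq> supp f0" using A.supp_open f0(1) z by blast
    obtain f' where f': "f' \<in> G1" "supp f' \<subseteq> cyl x n" "f' x \<in> cyl z m"
      using A.locally_dense[of z x n m] z f0(3) by blast
    have "\<phi> f' y = y" using not f' n by blast
    then have "match (f' x) y" using match_equivariant[OF xy f'(1)] by simp
    moreover have "f0 (f' x) \<noteq> f' x" using f'(3) m by (auto simp: supp_def)
    ultimately show ?thesis using f0(1) g unfolding match_def by blast
  qed
  obtain c where c: "c \<in> G1" "c x \<noteq> x" "supp c \<subseteq> cyl x n" using A.locally_moving by blast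
  have d: "\<phi> c \<in> G2" "\<phi> c \<noteq> id" using phi_closed phi_eq_id_iff c by auto
  then obtain p0 where p0: "p0 \<in> supp (\<phi> c)" using supp_empty_iff by blast
  moreover have "\<phi> c p0 \<in> supp (\<phi> c)" using supp_image[OF B.bijective[OF d(1)] p0] .
  moreover have "\<phi> c p0 \<noteq> p0" using p0 by (simp add: supp_def)
  \<comment> \<open>The support contains two distinct points, \<open>p0\<close> and its image, so
    one of them differs from \<open>y\<close>.\<close>
  ultimately obtain p where p: "p \<in> supp (\<phi> c)" "p \<noteq> y" by metis
  obtain i where i: "p i \<noteq> y i" using p(2) by (auto simp: fun_eq_iff)
  obtain m where m: "cyl p m \<subseteq> supp (\<phi> c)" using B.supp_open d(1) p(1) by blast
  define k where "k = max m (Suc i)"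
  have k: "cyl p k \<subseteq> supp (\<phi> c)" using m cyl_antimono[of m k p] by (auto simp: k_def)
  have disj: "cyl p k \<inter> cyl y k = {}" using i by (auto simp: cyl_def k_def)
  obtain e where e: "e \<in> G2" "e p \<noteq> p" "supp e \<subseteq> cyl p k" using B.locally_moving by blast
  obtain g where g: "g \<in> G2" "g y \<noteq> y" "supp g \<subseteq> cyl y k" using B.locally_moving by blast
  obtain f0 where f0: "f0 \<in> G1" "\<phi> f0 = e" using e(1) phi_image by blast
  \<comment> \<open>Pulling back controls supports only up to closure, which is harmless because
    \<open>cyl x n\<close> is closed.\<close>
  have "supp (\<phi> f0) \<subseteq> cl (supp (\<phi> c))" using f0 e(3) k subset_cl by blast
  then have "supp f0 \<subseteq> cl (supp c)" using below_phi f0 c by blast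
  then have "supp f0 \<subseteq> cyl x n" using cl_mono[OF c(3)] by (simp add: cl_cyl)
  moreover have "f0 \<noteq> id" using f0 e(2) phi_id by auto
  ultimately have "supp e \<inter> supp g \<noteq> {}" using meets f0 g by blast
  then show False using e(3) g(3) disj by blast
qed

text \<open>The defining condition is symmetric because \<open>\<phi>\<close> preserves disjointness
  of supports.\<close>

lemma match_inverse: "swap_group_iso.match G2 G1 (inv_into G1 \<phi>) y x \<longleftrightarrow> match x y"
proof -
  interpret inv: swap_group_iso G2 G1 "inv_into G1 \<phi>" by (rule inverse)
  have "supp (inv_into G1 \<phi> g) \<inter> supp f = {} \<longleftrightarrow> supp (\<phi> f) \<inter> supp g = {}"
    if "f \<in> G1" "g \<in> G2" for f g
    using disjoint_phi[OF that(1) phi_inv_into(1)[OF that(2)]] phi_inv_into(2)[OF that(2)]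
    by (simp add: Int_commute)
  then show ?thesis unfolding match_def inv.match_def by blast
qed

lemma match_moves_inverse:
  assumes "match x y" "g \<in> G2" "g y \<noteq> y"
  shows "\<exists>f\<in>G1. supp (\<phi> f) \<subseteq> supp g \<and> f x \<noteq> x"
proof -
  interpret inv: swap_group_iso G2 G1 "inv_into G1 \<phi>" by (rule inverse)
  obtain g' where "g' \<in> G2" "supp g' \<subseteq> supp g" "inv_into G1 \<phi> g' x \<noteq> x"
    using inv.match_moves[of y x g] assms match_inverse by blast
  then show ?thesis using phi_inv_into by metis
qed

text \<open>Distinct partners would be moved by disjointly supported elements. Beneath these lie
  images of \<open>f\<close> and \<open>f'\<close> that both move \<open>x\<close>, although their
  supports would have to be disjoint.\<close>

lemma match_unique:
  assumes "match x y" "match x y'"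
  shows "y = y'"
proof (rule ccontr)
  assume "y \<noteq> y'"
  then obtain i where i: "y i \<noteq> y' i" by (auto simp: fun_eq_iff)
  have disj: "cyl y (Suc i) \<inter> cyl y' (Suc i) = {}" using i by (auto simp: cyl_def)
  obtain g where g: "g \<in> G2" "g y \<noteq> y" "supp g \<subseteq> cyl y (Suc i)" using B.locally_moving by blast
  obtain g' where g': "g' \<in> G2" "g' y' \<noteq> y'" "supp g' \<subseteq> cyl y' (Suc i)"
    using B.locally_moving by blast
  obtain f where f: "f \<in> G1" "supp (\<phi> f) \<subseteq> supp g" "f x \<noteq> x"
    using match_moves_inverse assms(1) g by blast
  obtain f' where f': "f' \<in> G1" "supp (\<phi> f') \<subseteq> supp g'" "f' x \<noteq> x"
    using match_moves_inverse assms(2) g' by blast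
  have "supp (\<phi> f) \<inter> supp (\<phi> f') = {}" using f f' g g' disj by blast
  then have "supp f \<inter> supp f' = {}" using disjoint_phi f f' by blast
  then show False using f(3) f'(3) by (auto simp: supp_def)
qed

lemma match_continuous:
  assumes F: "\<And>x. match x (F x)"
  shows "continuous_map seq_top seq_top F"
  unfolding continuous_map_seq_top_iff
proof (intro allI)
  fix x n
  obtain g where g: "g \<in> G2" "g (F x) \<noteq> F x" "supp g \<subseteq> cyl (F x) n"
    using B.locally_moving by blast
  obtain f where f: "f \<in> G1" "supp (\<phi> f) \<subseteq> supp g" "f x \<noteq> x"
    using match_moves_inverse F g by blast
  obtain m where m: "cyl x m \<subseteq> supp f" using A.supp_open[of f x] f by (auto simp: supp_def)
  have "F z \<in> cyl (F x) n" if "z \<in> cyl x m" for z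
  proof -
    \<comment> \<open>So \<open>match_moves\<close> applies at \<open>z\<close> as well: an image
      supported in the closed cylinder around \<open>F x\<close> moves \<open>F z\<close>.\<close>
    have "f z \<noteq> z" using that m by (auto simp: supp_def)
    then obtain f' where f': "f' \<in> G1" "supp f' \<subseteq> supp f" "\<phi> f' (F z) \<noteq> F z"
      using match_moves[OF F f(1)] by blast
    then have "supp (\<phi> f') \<subseteq> cl (supp (\<phi> f))" using below_phi f(1) subset_cl by blast
    also have "\<dots> \<subseteq> cl (cyl (F x) n)" using f(2) g(3) by (intro cl_mono) blast
    finally show ?thesis using f'(3) by (auto simp: supp_def cl_cyl)
  qed
  then show "\<exists>m. F ` cyl x m \<subseteq> cyl (F x) n" by blast
qed

theorem induced_by_homeomorphism:
  "\<exists>F. homeomorphic_map seq_top seq_top F \<and> (\<forall>g\<in>G1. \<phi> g = F \<circ> g \<circ> inv_into UNIV F)"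
proof -
  interpret inv: swap_group_iso G2 G1 "inv_into G1 \<phi>" by (rule inverse)
  obtain F where F: "\<And>x. match x (F x)" using match_exists by metis
  obtain F' where F': "\<And>y. inv.match y (F' y)" using inv.match_exists by metis
  have F'F: "F' (F x) = x" for x
    using inv.match_unique[OF F'] F match_inverse by blast
  have FF': "F (F' y) = y" for y
    using match_unique[OF F] F' match_inverse by blast
  have "homeomorphic_maps seq_top seq_top F F'"
    unfolding homeomorphic_maps_def
    using match_continuous[OF F] inv.match_continuous[OF F'] F'F FF' by simp
  moreover have "inv_into UNIV F = F'"
    by (rule inv_unique_comp) (auto simp: F'F FF')
  moreover have "\<phi> g = F \<circ> g \<circ> F'" if "g \<in> G1" for g
  proof
    fix y
    \<comment> \<open>The point \<open>g (F' y)\<close> is also matched with its value under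
      \<open>F\<close>, so uniqueness identifies the two.\<close>
    have "match (g (F' y)) (\<phi> g y)" using match_equivariant[OF F that, of "F' y"] FF' by simp
    then show "\<phi> g y = (F \<circ> g \<circ> F') y" using match_unique F by auto
  qed
  ultimately show ?thesis using homeomorphic_maps_imp_map by metis
qed

end

section \<open>From the given groups to the abstract setting\<close>

lemma swap_group_of_homeo_group:
  fixes G :: "((nat \<Rightarrow> 'a::finite) \<Rightarrow> nat \<Rightarrow> 'a) set"
  assumes card: "CARD('a) \<ge> 2" and G: "homeo_group G" and V: "higman_thompson \<subseteq> G"
  shows "swap_group G"
proof -
  have homeo: "homeomorphic_map seq_top seq_top f" if "f \<in> G" for f
    using G that by (auto simp: homeo_group_def)
  have grp: "group (comp_monoid G)" using G by (simp add: homeo_group_def)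
  have bij: "bij f" if "f \<in> G" for f
    using homeo[OF that] by (simp add: homeomorphic_eq_everything_map bij_def)
  show ?thesis
  proof
    fix f g assume "f \<in> G" "g \<in> G"
    then show "f \<circ> g \<in> G"
      using monoid.m_closed[OF group.is_monoid[OF grp]] by (simp add: comp_monoid_def)
  next
    show "id \<in> G" using monoid.one_closed[OF group.is_monoid[OF grp]] by (simp add: comp_monoid_def)
  next
    fix f assume f: "f \<in> G"
    then obtain g where "g \<in> G" "g \<circ> f = id"
      using group.l_inv_ex[OF grp, of f] by (auto simp: comp_monoid_def)
    \<comment> \<open>The group axioms supply a left inverse in \<open>G\<close>; surjectivity of
      \<open>f\<close> identifies it with \<open>finv f\<close>.\<close>
    moreover have "finv f = g"
    proof
      fix y
      have "g (f (finv f y)) = finv f y" using \<open>g \<circ> f = id\<close> by (simp add: fun_eq_iff)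
      then show "finv f y = g y" by (simp add: bij_inv_apply(1)[OF bij[OF f]])
    qed
    ultimately show "finv f \<in> G" by simp
  next
    fix f assume "f \<in> G" then show "bij f" by (rule bij)
  next
    fix f x n assume "f \<in> G"
    then show "\<exists>m. f ` cyl x m \<subseteq> cyl (f x) n"
      using homeomorphic_imp_continuous_map[OF homeo] continuous_map_seq_top_iff by blast
  next
    fix p q n show "swap_prefix p q n \<in> G" using swap_prefix_higman_thompson V by blast
  next
    show "\<exists>a b :: 'a. a \<noteq> b"
    proof (rule ccontr)
      assume "\<not> ?thesis"
      then have "CARD('a) \<le> Suc 0" by (subst card_le_Suc0_iff_eq) auto
      then show False using card by simp
    qed
  qed
qed

theorem theorem7p4:
  fixes G1 :: "((nat \<Rightarrow> 'a::finite) \<Rightarrow> (nat \<Rightarrow> 'a)) set"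
    and G2 :: "((nat \<Rightarrow> 'b::finite) \<Rightarrow> (nat \<Rightarrow> 'b)) set"
    and \<phi> :: "((nat \<Rightarrow> 'a) \<Rightarrow> (nat \<Rightarrow> 'a)) \<Rightarrow> ((nat \<Rightarrow> 'b) \<Rightarrow> (nat \<Rightarrow> 'b))"
  assumes "CARD('a) \<ge> 2" and "CARD('b) \<ge> 2"
    and "homeo_group G1" and "higman_thompson \<subseteq> G1"
    and "homeo_group G2" and "higman_thompson \<subseteq> G2"
    and "\<phi> \<in> iso (comp_monoid G1) (comp_monoid G2)"
  shows "\<exists>F :: (nat \<Rightarrow> 'a) \<Rightarrow> (nat \<Rightarrow> 'b).
           homeomorphic_map seq_top seq_top F \<and> (\<forall>g\<in>G1. \<phi> g = F \<circ> g \<circ> Hilbert_Choice.inv F)"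
proof -
  interpret A: swap_group G1 using assms by (intro swap_group_of_homeo_group)
  interpret B: swap_group G2 using assms by (intro swap_group_of_homeo_group)
  interpret swap_group_iso G1 G2 \<phi>
    by unfold_locales (use assms(7) in \<open>auto simp: iso_def hom_def comp_monoid_def\<close>)
  show ?thesis by (rule induced_by_homeomorphism)
qed

end
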